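(* Let $\hat z\in\mathbb R^m$ be fixed and let $\tau_{\mathcal R}>0$ and $\tau_\psi>0$ be prescribed. Suppose that: (1) for each $k=1,\dots,m$ there is $L_{A,k}>0$ with $\left\|\frac{\partial A}{\partial z_k}(z)-\frac{\partial A}{\partial z_k}(z')\right\|_2\le L_{A,k}\|z-z'\|_2$ for all $z,z'\in\mathbb R^m$; (2) there is $C_A>0$ with $\left\|\frac{\partial A}{\partial z_k}(z)\right\|_2\le C_A$ for all $z\in\mathbb R^m$ and $k=1,\dots,m$; (3) there is $L_b>0$ with $\left\|\frac{\partial b}{\partial z}(z)-\frac{\partial b}{\partial z}(z')\right\|_2\le L_b\|z-z'\|_2$ for all $z,z'\in\mathbb R^m$; (4) there is $C_b>0$ with $\left\|\frac{\partial b}{\partial z}(z)\right\|_2\le C_b$ for all $z\in\mathbb R^m$; (5) $F\in C^1(\mathbb R^m\times\mathbb R^n,\mathbb R)$ is $L_F$-smooth, i.e. $\|\nabla F(w_1)-\nabla F(w_2)\|_2\le L_F\|w_1-w_2\|_2$ for all $w_1,w_2\in\mathbb R^m\times\mathbb R^n$. Then, for every $y\in\mathcal Y_{\hat z}$ and every $\psi\in\mathcal A_{\hat z,y}$, the inexact adjoint gradient $\overline\nabla\widetilde F(\hat z)$ formed from $(y,\psi)$ satisfies $$\|\overline\nabla\widetilde F(\hat z)-\nabla\widetilde F(\hat z)\|_2\le D_{\mathcal R}(\hat z)\,\tau_{\mathcal R}+D_\psi(\hat z)\,\tau_\psi,$$ where $$D_{\mathcal R}(\hat z)=L_FC_{\mathcal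 R}(\hat z)+L_F\big(\sqrt m\,C_AC_{\mathcal Y_{\hat z}}+C_b\big)C_{\mathcal R}(\hat z)^2+\sqrt m\,C_AM_F(\hat z)C_{\mathcal R}(\hat z)^2,$$ $$D_\psi(\hat z)=\big(\sqrt m\,C_AC_{\mathcal Y_{\hat z}}+C_b\big)C_{\mathcal R}(\hat z).$$
   Context: Vectors carry the Euclidean norm $\|\cdot\|_2$ and matrices the induced spectral norm $\|\cdot\|_2$. The residual is affine in the state: $R(z,y)=A(z)y-b(z)$, where $A:\mathbb R^m\to GL(n)$ (invertible real $n\times n$ matrices) and $b:\mathbb R^m\to\mathbb R^n$ are $C^1$. Its partial Jacobian in $z$ is the $n\times m$ matrix $\frac{\partial R}{\partial z}(z,y)=\frac{\partial A}{\partial z}(z)y-\frac{\partial b}{\partial z}(z)$, where $\frac{\partial A}{\partial z}(z)y$ is the matrix whose $k$-th column is $\frac{\partial A}{\partial z_k}(z)y$. $F:\mathbb R^m\times\mathbb R^n\to\mathbb R$ is the full objective, with partial gradients $\nabla_zF,\nabla_yF$. For fixed $\hat z$: the exact state is $y^*_{\hat z}=A(\hat z)^{-1}b(\hat z)$; $\mathcal Y_{\hat z}=\{y\in\mathbb R^n: \|A(\hat z)y-b(\hat z)\|_2\le\tau_{\mathcal R}\}$; $C_{\mathcal R}(\hat z)=\|A(\hat z)^{-1}\|_2$; for $y\in\mathcal Y_{\hat z}$ the exact adjoint $\psi^*_{\hat z,y}$ is the solution of $A(\hat z)^{\mathsf T}\psi^*_{\hat z,y}=\nabla_yF(\hat z,y)$;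 $\mathcal A_{\hat z,y}=\{\psi\in\mathbb R^n:\|A(\hat z)^{\mathsf T}\psi-\nabla_yF(\hat z,y)\|_2\le\tau_\psi\}$; $M_F(\hat z)=\sup_{y\in\mathcal Y_{\hat z}}\|\nabla_yF(\hat z,y)\|_2$; $C_{\mathcal Y_{\hat z}}=\sup_{y\in\mathcal Y_{\hat z}}\|y\|_2$. The inexact adjoint gradient formed from $y\in\mathcal Y_{\hat z}$, $\psi\in\mathcal A_{\hat z,y}$ is $\overline\nabla\widetilde F(\hat z)=\nabla_zF(\hat z,y)-\left[\frac{\partial R}{\partial z}(\hat z,y)\right]^{\mathsf T}\psi$. The exact reduced gradient (the gradient of $\widetilde F(z)=F(z,y^*_z)$ at $\hat z$) is $\nabla\widetilde F(\hat z)=\nabla_zF(\hat z,y^*_{\hat z})-\left[\frac{\partial R}{\partial z}(\hat z,y^*_{\hat z})\right]^{\mathsf T}\psi^*_{\hat z,y^*_{\hat z}}$. *)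

theory Defs
  imports "HOL-Analysis.Analysis"
begin

definition C1 :: "('a::real_normed_vector \<Rightarrow> 'b::real_normed_vector) \<Rightarrow> bool" where
  "C1 f \<longleftrightarrow> (\<exists>f' :: 'a \<Rightarrow> 'a \<Rightarrow>\<^sub>L 'b.
      (\<forall>x. (f has_derivative blinfun_apply (f' x)) (at x)) \<and> continuous_on UNIV f')"

definition grad :: "('a::real_inner \<Rightarrow> real) \<Rightarrow> 'a \<Rightarrow> 'a" where
  "grad f x = (THE D. GDERIV f x :> D)"

definition grad_z :: "('a::real_inner \<times> 'b::real_inner \<Rightarrow> real) \<Rightarrow> 'a \<Rightarrow> 'b \<Rightarrow> 'a" where
  "grad_z F z y = grad (\<lambda>z'. F (z', y)) z"

definition grad_y :: "('a::real_inner \<times> 'b::real_inner \<Rightarrow> real) \<Rightarrow> 'a \<Rightarrow> 'b \<Rightarrow> 'b" where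
  "grad_y F z y = grad (\<lambda>y'. F (z, y')) y"

definition partial_deriv :: "'m::finite \<Rightarrow> (real^'m \<Rightarrow> 'b::real_normed_vector) \<Rightarrow> real^'m \<Rightarrow> 'b" where
  "partial_deriv k f z = vector_derivative (\<lambda>t. f (z + t *\<^sub>R axis k 1)) (at 0)"

(* The library norm on real^'n^'m is the Frobenius norm, so the spectral norm is
   introduced separately as the operator norm. *)
definition spectral_norm :: "real^'n^'m \<Rightarrow> real" where
  "spectral_norm M = onorm (\<lambda>x. M *v x)"

definition residual ::
  "(real^'m \<Rightarrow> real^'n^'n) \<Rightarrow> (real^'m \<Rightarrow> real^'n) \<Rightarrow> real^'m \<Rightarrow> real^'n \<Rightarrow> real^'n" where
  "residual A b z y = A z *v y - b z"

(* The partial Jacobian of the residual in z, with n rows and m columns; the expression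
   through the partial derivatives of A and b is lemma residual_jacobian_eq. *)
definition residual_jacobian ::
  "(real^'m \<Rightarrow> real^'n^'n) \<Rightarrow> (real^'m \<Rightarrow> real^'n) \<Rightarrow> real^'m \<Rightarrow> real^'n \<Rightarrow> real^'m^'n" where
  "residual_jacobian A b z y = jacobian (\<lambda>z'. residual A b z' y) (at z)"

definition exact_state ::
  "(real^'m \<Rightarrow> real^'n^'n) \<Rightarrow> (real^'m \<Rightarrow> real^'n) \<Rightarrow> real^'m \<Rightarrow> real^'n" where
  "exact_state A b z = matrix_inv (A z) *v b z"

definition inexact_states ::
  "(real^'m \<Rightarrow> real^'n^'n) \<Rightarrow> (real^'m \<Rightarrow> real^'n) \<Rightarrow> real \<Rightarrow> real^'m \<Rightarrow> (real^'n) set" where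
  "inexact_states A b \<tau>\<^sub>R z = {y. norm (residual A b z y) \<le> \<tau>\<^sub>R}"

definition exact_adjoint ::
  "(real^'m \<Rightarrow> real^'n^'n) \<Rightarrow> ((real^'m) \<times> (real^'n) \<Rightarrow> real) \<Rightarrow> real^'m \<Rightarrow> real^'n \<Rightarrow> real^'n" where
  "exact_adjoint A F z y = (THE \<psi>. transpose (A z) *v \<psi> = grad_y F z y)"

definition inexact_adjoints ::
  "(real^'m \<Rightarrow> real^'n^'n) \<Rightarrow> ((real^'m) \<times> (real^'n) \<Rightarrow> real) \<Rightarrow> real \<Rightarrow> real^'m \<Rightarrow> real^'n
    \<Rightarrow> (real^'n) set" where
  "inexact_adjoints A F \<tau>\<^sub>\<psi> z y = {\<psi>. norm (transpose (A z) *v \<psi> - grad_y F z y) \<le> \<tau>\<^sub>\<psi>}"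

definition C_R :: "(real^'m \<Rightarrow> real^'n^'n) \<Rightarrow> real^'m \<Rightarrow> real" where
  "C_R A z = spectral_norm (matrix_inv (A z))"

(* Under the hypotheses of the theorem the two suprema below are taken over nonempty
   bounded sets of reals. *)
definition M_F ::
  "(real^'m \<Rightarrow> real^'n^'n) \<Rightarrow> (real^'m \<Rightarrow> real^'n) \<Rightarrow> ((real^'m) \<times> (real^'n) \<Rightarrow> real) \<Rightarrow> real
    \<Rightarrow> real^'m \<Rightarrow> real" where
  "M_F A b F \<tau>\<^sub>R z = (SUP y \<in> inexact_states A b \<tau>\<^sub>R z. norm (grad_y F z y))"

definition C_Y ::
  "(real^'m \<Rightarrow> real^'n^'n) \<Rightarrow> (real^'m \<Rightarrow> real^'n) \<Rightarrow> real \<Rightarrow> real^'m \<Rightarrow> real" where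
  "C_Y A b \<tau>\<^sub>R z = (SUP y \<in> inexact_states A b \<tau>\<^sub>R z. norm y)"

definition adjoint_gradient ::
  "(real^'m \<Rightarrow> real^'n^'n) \<Rightarrow> (real^'m \<Rightarrow> real^'n) \<Rightarrow> ((real^'m) \<times> (real^'n) \<Rightarrow> real)
    \<Rightarrow> real^'m \<Rightarrow> real^'n \<Rightarrow> real^'n \<Rightarrow> real^'m" where
  "adjoint_gradient A b F z y \<psi> = grad_z F z y - transpose (residual_jacobian A b z y) *v \<psi>"

definition reduced_objective ::
  "(real^'m \<Rightarrow> real^'n^'n) \<Rightarrow> (real^'m \<Rightarrow> real^'n) \<Rightarrow> ((real^'m) \<times> (real^'n) \<Rightarrow> real)
    \<Rightarrow> real^'m \<Rightarrow> real" where
  "reduced_objective A b F z = F (z, exact_state A b z)"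

(* The genuine gradient of the reduced objective; the exact adjoint formula for it is
   lemma reduced_gradient_eq. *)
definition reduced_gradient ::
  "(real^'m \<Rightarrow> real^'n^'n) \<Rightarrow> (real^'m \<Rightarrow> real^'n) \<Rightarrow> ((real^'m) \<times> (real^'n) \<Rightarrow> real)
    \<Rightarrow> real^'m \<Rightarrow> real^'m" where
  "reduced_gradient A b F z = grad (reduced_objective A b F) z"


lemma grad_unique: "GDERIV f x :> D \<Longrightarrow> grad f x = D"
proof -
  assume D: "GDERIV f x :> D"
  have "E = D" if "GDERIV f x :> E" for E
  proof -
    have "(\<lambda>h. inner h E) = (\<lambda>h. inner h D)"
      using that D unfolding gderiv_def by (rule has_derivative_unique)
    then have "inner h (E - D) = 0" for h
      by (metis inner_diff_right right_minus_eq)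
    then show ?thesis by (metis inner_eq_zero_iff right_minus_eq)
  qed
  with D show ?thesis unfolding grad_def by (intro the_equality)
qed

lemma has_derivative_imp_GDERIV:
  fixes f :: "'a::euclidean_space \<Rightarrow> real"
  assumes "(f has_derivative f') (at x)"
  shows "GDERIV f x :> grad f x"
proof -
  let ?D = "\<Sum>i\<in>Basis. f' i *\<^sub>R i"
  have lin: "linear f'" using assms has_derivative_linear by blast
  have "f' h = inner h ?D" for h
  proof -
    have "f' h = f' (\<Sum>i\<in>Basis. inner h i *\<^sub>R i)" by (simp add: euclidean_representation)
    also have "\<dots> = (\<Sum>i\<in>Basis. inner h i * f' i)"
      using lin by (simp add: linear_sum linear_cmul)
    finally show ?thesis by (simp add: inner_sum_right mult.commute)
  qed
  then have "f' = (\<lambda>h. inner h ?D)" by blast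
  then have "GDERIV f x :> ?D" using assms unfolding gderiv_def by simp
  then show ?thesis using grad_unique by metis
qed

lemma bounded_bilinear_matrix_vector:
  "bounded_bilinear (\<lambda>(M::real^'n^'m) x. M *v x)"
  unfolding bilinear_conv_bounded_bilinear[symmetric] bilinear_def
  by (auto intro!: linearI simp: matrix_vector_right_distrib matrix_vector_mult_add_rdistrib
      matrix_vector_mult_scaleR scaleR_matrix_vector_assoc)

lemma partial_deriv_eq:
  assumes "(f has_derivative f') (at z)"
  shows "partial_deriv k f z = f' (axis k 1)"
proof -
  have g: "((\<lambda>t::real. z + t *\<^sub>R axis k 1) has_derivative (\<lambda>t. t *\<^sub>R axis k 1)) (at 0)"
    by (auto intro!: derivative_eq_intros)
  have "((\<lambda>t::real. f (z + t *\<^sub>R axis k 1)) has_derivative (\<lambda>t. f' (t *\<^sub>R axis k 1))) (at 0)"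
    using has_derivative_compose[OF g, of f f'] assms by simp
  moreover have "(\<lambda>t. f' (t *\<^sub>R axis k 1)) = (\<lambda>t. t *\<^sub>R f' (axis k 1))"
    using has_derivative_linear[OF assms] by (simp add: linear_cmul)
  ultimately show ?thesis
    unfolding partial_deriv_def
    by (auto intro!: vector_derivative_at simp: has_vector_derivative_def)
qed

lemma C1_imp_differentiable: "C1 f \<Longrightarrow> f differentiable (at x)"
  unfolding C1_def differentiable_def by blast

lemma residual_has_derivative:
  assumes "(A has_derivative A') (at z)" "(b has_derivative b') (at z)"
  shows "((\<lambda>z'. residual A b z' y) has_derivative (\<lambda>h. A' h *v y - b' h)) (at z)"
  unfolding residual_def
  using bounded_bilinear.bounded_linear_left[OF bounded_bilinear_matrix_vector]
  by (intro has_derivative_diff assms bounded_linear.has_derivative[of "\<lambda>M. M *v y"])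

lemma residual_jacobian_eq:
  fixes A :: "real^'m \<Rightarrow> real^'n^'n" and b :: "real^'m \<Rightarrow> real^'n"
  assumes "C1 A" "C1 b"
  shows "residual_jacobian A b z y =
    (\<chi> i k. (partial_deriv k A z *v y) $ i) - jacobian b (at z)"
proof -
  obtain A' b' where d: "(A has_derivative A') (at z)" "(b has_derivative b') (at z)"
    using assms C1_imp_differentiable[of A z] C1_imp_differentiable[of b z]
    unfolding differentiable_def by blast
  note r = residual_has_derivative[OF d, of y]
  have "frechet_derivative (\<lambda>z'. residual A b z' y) (at z) = (\<lambda>h. A' h *v y - b' h)"
    using frechet_derivative_at[OF r] by simp
  moreover have "frechet_derivative b (at z) = b'" using frechet_derivative_at[OF d(2)] by simp
  ultimately show ?thesis
    unfolding residual_jacobian_def jacobian_def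
    by (simp add: vec_eq_iff matrix_def partial_deriv_eq[OF d(1)])
qed

lemma matrix_inv_right: "invertible (M::real^'n^'n) \<Longrightarrow> M ** matrix_inv M = mat 1"
  and matrix_inv_left: "invertible (M::real^'n^'n) \<Longrightarrow> matrix_inv M ** M = mat 1"
  unfolding invertible_def matrix_inv_def
  by (metis (mono_tags, lifting) someI_ex)+

lemma exact_state_solves:
  fixes A :: "real^'m \<Rightarrow> real^'n^'n"
  assumes "invertible (A z)"
  shows "A z *v exact_state A b z = b z"
  using assms by (simp add: exact_state_def matrix_vector_mul_assoc matrix_inv_right)

lemma differentiable_cartI:
  fixes f :: "'a::real_normed_vector \<Rightarrow> real^'n"
  assumes "\<And>k. (\<lambda>x. f x $ k) differentiable (at z)"
  shows "f differentiable (at z)"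
  unfolding differentiable_componentwise_within[of f]
  using assms by (auto simp: Basis_vec_def inner_axis)

lemma differentiable_nth:
  assumes "f differentiable (at z)"
  shows "(\<lambda>x. f x $ k) differentiable (at z)"
  using assms bounded_linear.has_derivative[OF bounded_linear_vec_nth]
  unfolding differentiable_def by blast

lemma differentiable_prod':
  fixes f :: "'i \<Rightarrow> 'a::real_normed_vector \<Rightarrow> real"
  assumes "\<And>i. i \<in> I \<Longrightarrow> f i differentiable (at z)"
  shows "(\<lambda>x. \<Prod>i\<in>I. f i x) differentiable (at z)"
proof -
  obtain f' where "\<And>i. i \<in> I \<Longrightarrow> (f i has_derivative f' i) (at z)"
    using bchoice[of I "\<lambda>i D. (f i has_derivative D) (at z)"] assms
    unfolding differentiable_def by blast
  then show ?thesis unfolding differentiable_def by (blast intro: has_derivative_prod)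
qed

lemma differentiable_det:
  fixes M :: "'a::real_normed_vector \<Rightarrow> real^'n^'n"
  assumes "\<And>i j. (\<lambda>x. M x $ i $ j) differentiable (at z)"
  shows "(\<lambda>x. det (M x)) differentiable (at z)"
  unfolding det_def
proof (rule differentiable_sum)
  show "\<forall>p\<in>{p. p permutes (UNIV::'n set)}.
      (\<lambda>x. of_int (sign p) * (\<Prod>i\<in>UNIV. M x $ i $ p i)) differentiable (at z)"
    by (intro ballI differentiable_mult differentiable_const differentiable_prod' assms)
qed (simp add: finite_permutations)

lemma exact_state_differentiable:
  fixes A :: "real^'m \<Rightarrow> real^'n^'n"
  assumes "C1 A" "C1 b" and inv: "\<And>z. invertible (A z)"
  shows "exact_state A b differentiable (at z)"
proof (rule differentiable_cartI)
  fix k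
  have nz: "det (A x) \<noteq> 0" for x using inv invertible_det_nz by blast
  have A: "(\<lambda>x. A x $ i $ j) differentiable (at z)" for i j
    by (intro differentiable_nth C1_imp_differentiable assms(1))
  have b: "(\<lambda>x. b x $ i) differentiable (at z)" for i
    by (intro differentiable_nth C1_imp_differentiable assms(2))
  have "exact_state A b x $ k = det (\<chi> i j. if j = k then b x $ i else A x $ i $ j) / det (A x)" for x
    using exact_state_solves[where A=A and z=x and b=b, OF inv] unfolding cramer[OF nz[of x]]
    by (metis (no_types, lifting) vec_lambda_beta)
  moreover have "(\<lambda>x. det (\<chi> i j. if j = k then b x $ i else A x $ i $ j) / det (A x))
      differentiable (at z)"
  proof (intro differentiable_divide differentiable_det A nz)
    fix i j
    show "(\<lambda>x. (\<chi> i j. if j = k then b x $ i else A x $ i $ j) $ i $ j) differentiable (at z)"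
      using A[of i j] b[of i] by (cases "j = k") simp_all
  qed
  ultimately show "(\<lambda>x. exact_state A b x $ k) differentiable (at z)" by simp
qed

lemma exact_adjoint_solves:
  fixes A :: "real^'m \<Rightarrow> real^'n^'n"
  assumes "invertible (A z)"
  shows "transpose (A z) *v exact_adjoint A F z y = grad_y F z y"
proof -
  have inv: "invertible (transpose (A z))" using assms by (rule transpose_invertible)
  have "\<exists>!\<psi>. transpose (A z) *v \<psi> = grad_y F z y"
  proof (rule ex1I)
    show "transpose (A z) *v (matrix_inv (transpose (A z)) *v grad_y F z y) = grad_y F z y"
      using inv by (simp add: matrix_vector_mul_assoc matrix_inv_right del: transpose_matrix_vector)
  next
    fix \<psi> assume "transpose (A z) *v \<psi> = grad_y F z y"
    then have "matrix_inv (transpose (A z)) *v (transpose (A z) *v \<psi>)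
        = matrix_inv (transpose (A z)) *v grad_y F z y" by simp
    then show "\<psi> = matrix_inv (transpose (A z)) *v grad_y F z y"
      using inv by (simp add: matrix_vector_mul_assoc matrix_inv_left del: transpose_matrix_vector)
  qed
  then show ?thesis unfolding exact_adjoint_def by (rule theI')
qed

lemma inner_transpose: "inner h (transpose M *v p) = inner (M *v h) (p::real^'k)"
  for M :: "real^'n^'k"
  using dot_lmul_matrix[of p M h] by (simp add: inner_commute)

lemma reduced_gradient_eq:
  fixes A :: "real^'m \<Rightarrow> real^'n^'n" and b :: "real^'m \<Rightarrow> real^'n"
    and z :: "real^'m"
  assumes "C1 A" "C1 b" "C1 F" and inv: "\<And>z. invertible (A z)"
  defines "y \<equiv> exact_state A b z"
  shows "GDERIV (reduced_objective A b F) z :> reduced_gradient A b F z"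
    and "reduced_gradient A b F z = adjoint_gradient A b F z y (exact_adjoint A F z y)"
proof -
  obtain A' b' Y' F' where A: "(A has_derivative A') (at z)" and b: "(b has_derivative b') (at z)"
    and Y: "(exact_state A b has_derivative Y') (at z)" and F: "(F has_derivative F') (at (z, y))"
    using C1_imp_differentiable[OF assms(1), of z] C1_imp_differentiable[OF assms(2), of z]
      C1_imp_differentiable[OF assms(3), of "(z, y)"] exact_state_differentiable[OF assms(1,2) inv, of z]
    unfolding differentiable_def by blast
  let ?\<psi> = "exact_adjoint A F z y"
  have linF: "linear F'" using F has_derivative_linear by blast
  have "((\<lambda>x. A x *v exact_state A b x) has_derivative (\<lambda>h. A z *v Y' h + A' h *v y)) (at z)"
    using bounded_bilinear.FDERIV[OF bounded_bilinear_matrix_vector A Y] by (simp add: y_def)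
  moreover have "(\<lambda>x. A x *v exact_state A b x) = b"
    using exact_state_solves inv by blast
  ultimately have b'eq: "b' = (\<lambda>h. A z *v Y' h + A' h *v y)"
    using b has_derivative_unique by auto
  have Fz: "((\<lambda>z'. F (z', y)) has_derivative (\<lambda>h. F' (h, 0))) (at z)"
    by (rule has_derivative_compose[of "\<lambda>z'. (z', y)" "\<lambda>h. (h, 0)", OF _ F, simplified])
      (auto intro!: derivative_eq_intros)
  have Fy: "((\<lambda>y'. F (z, y')) has_derivative (\<lambda>h. F' (0, h))) (at y)"
    by (rule has_derivative_compose[of "\<lambda>y'. (z, y')" "\<lambda>h. (0, h)", OF _ F, simplified])
      (auto intro!: derivative_eq_intros)
  have gz: "F' (h, 0) = inner h (grad_z F z y)" for h
    using fun_cong[OF has_derivative_unique[OF Fz has_derivative_imp_GDERIV[OF Fz, unfolded gderiv_def]], of h]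
    unfolding grad_z_def .
  have gy: "F' (0, h) = inner h (grad_y F z y)" for h
    using fun_cong[OF has_derivative_unique[OF Fy has_derivative_imp_GDERIV[OF Fy, unfolded gderiv_def]], of h]
    unfolding grad_y_def .
  have J: "residual_jacobian A b z y *v h = A' h *v y - b' h" for h
  proof -
    note r = residual_has_derivative[OF A b, of y]
    have "((\<lambda>z'. residual A b z' y) has_derivative (\<lambda>h. residual_jacobian A b z y *v h)) (at z)"
      using differentiableI[OF r] unfolding residual_jacobian_def by (subst (asm) jacobian_works)
    then show ?thesis using fun_cong[OF has_derivative_unique[OF _ r], of _ h] by simp
  qed
  have pair: "((\<lambda>x. (x, exact_state A b x)) has_derivative (\<lambda>h. (h, Y' h))) (at z)"
    by (intro has_derivative_Pair has_derivative_ident Y)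
  have R: "(reduced_objective A b F has_derivative (\<lambda>h. F' (h, Y' h))) (at z)"
    unfolding reduced_objective_def
    using has_derivative_compose[OF pair, of F F'] F by (simp add: y_def)
  have "F' (h, Y' h) = inner h (adjoint_gradient A b F z y ?\<psi>)" for h
  proof -
    have "F' (h, Y' h) = F' (h, 0) + F' (0, Y' h)"
      using linear_add[OF linF, of "(h, 0)" "(0, Y' h)"] by simp
    also have "\<dots> = inner h (grad_z F z y) + inner (Y' h) (transpose (A z) *v ?\<psi>)"
      using exact_adjoint_solves[where A=A and z=z and F=F and y=y, OF inv] by (simp only: gz gy)
    also have "inner (Y' h) (transpose (A z) *v ?\<psi>) = inner (A z *v Y' h) ?\<psi>"
      by (simp only: inner_transpose)
    also have "\<dots> = - inner (residual_jacobian A b z y *v h) ?\<psi>"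
      by (simp add: J b'eq inner_diff_left inner_add_left)
    also have "inner (residual_jacobian A b z y *v h) ?\<psi>
        = inner h (transpose (residual_jacobian A b z y) *v ?\<psi>)"
      by (simp only: inner_transpose)
    finally show ?thesis by (simp add: adjoint_gradient_def inner_diff_right)
  qed
  then have G: "GDERIV (reduced_objective A b F) z :> adjoint_gradient A b F z y ?\<psi>"
    using R unfolding gderiv_def by simp
  then show eq: "reduced_gradient A b F z = adjoint_gradient A b F z y ?\<psi>"
    unfolding reduced_gradient_def by (rule grad_unique)
  show "GDERIV (reduced_objective A b F) z :> reduced_gradient A b F z"
    using G by (simp add: eq)
qed

end

theory Submission
  imports Defs
begin

text \<open>
  With \<open>y\<^sup>*\<close> the exact state, \<open>\<psi>\<^sub>y\<close> the exact adjoint at \<open>y\<close> and \<open>\<psi>\<^sup>*\<close> the exact adjoint at \<open>y\<^sup>*\<close>,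
  the error of the gradient splits as
  \<open>(\<nabla>\<^sub>zF(y) - \<nabla>\<^sub>zF(y\<^sup>*)) - J(y)\<^sup>T(\<psi> - \<psi>\<^sub>y) - J(y)\<^sup>T(\<psi>\<^sub>y - \<psi>\<^sup>*) - (J(y) - J(y\<^sup>*))\<^sup>T\<psi>\<^sup>*\<close>.
  Residuals control errors through the inverse of \<open>A\<close> and of its transpose, which have the same
  spectral norm, and the Jacobian \<open>J\<close> is affine in the state.
\<close>

section \<open>Spectral norms and transposed matrices\<close>

lemma spectral_norm_bound: "norm (M *v x) \<le> spectral_norm M * norm x"
  for M :: "real^'n^'k"
  unfolding spectral_norm_def by (rule onorm) (rule matrix_vector_mul_bounded_linear)

lemma spectral_norm_nonneg: "0 \<le> spectral_norm M"
  for M :: "real^'n^'k"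
  unfolding spectral_norm_def by (rule onorm_pos_le) (rule matrix_vector_mul_bounded_linear)

text \<open>For \<open>v = transpose M *v p\<close>, moving \<open>M\<close> across the inner
  product gives |v|^2 = <M v, p> \<le> K |v| |p|, and |v| cancels. Allowing any bound
  \<open>K\<close> lets explicit Jacobian bounds pass to the transpose directly.\<close>

lemma norm_transpose_mult_le:
  fixes M :: "real^'n^'k"
  assumes "\<And>h. norm (M *v h) \<le> K * norm h"
  shows "norm (transpose M *v p) \<le> K * norm p"
proof -
  let ?v = "transpose M *v p"
  have "norm ?v * norm ?v = inner ?v ?v"
    by (simp add: power2_norm_eq_inner flip: power2_eq_square)
  also have "\<dots> = inner (M *v ?v) p" by (rule inner_transpose)
  also have "\<dots> \<le> norm (M *v ?v) * norm p" by (rule norm_cauchy_schwarz)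
  also have "\<dots> \<le> K * norm ?v * norm p" by (intro mult_right_mono assms norm_ge_zero)
  finally have *: "norm ?v * norm ?v \<le> norm ?v * (K * norm p)" by (simp only: ac_simps)
  show ?thesis
  proof (cases "?v = 0")
    case True
    \<comment> \<open>With a vanishing left side the claim still needs a nonnegative right side; the
      sign of \<open>K\<close> is read off from the assumption at a unit vector.\<close>
    have "0 \<le> K * norm p"
    proof (cases "p = 0")
      case False
      have "0 \<le> K * norm (axis undefined 1 :: real^'n)"
        using assms[of "axis undefined 1"] norm_ge_zero order_trans by blast
      then show ?thesis by simp
    qed simp
    with True show ?thesis by (simp only: norm_zero)
  next
    case False
    then have "0 < norm ?v" by (rule zero_less_norm_iff[THEN iffD2])
    with * show ?thesis by (simp only: mult_le_cancel_left_pos)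
  qed
qed

section \<open>The Jacobian of the residual as a function of the state\<close>

text \<open>Cauchy-Schwarz against the all-ones vector; this is the origin of the factor sqrt m in
  the final constants.\<close>

lemma sum_abs_le_sqrt_card_norm:
  fixes h :: "real^'m"
  shows "(\<Sum>k\<in>UNIV. \<bar>h $ k\<bar>) \<le> sqrt (real CARD('m)) * norm h"
proof -
  have "(\<Sum>k\<in>UNIV. \<bar>1\<bar> * \<bar>h $ k\<bar>) \<le> L2_set (\<lambda>_. 1) (UNIV::'m set) * L2_set (\<lambda>k. h $ k) UNIV"
    by (rule L2_set_mult_ineq)
  then show ?thesis by (simp add: L2_set_def norm_vec_def)
qed

text \<open>Applied to \<open>h\<close>, the matrix combines its columns \<open>P k *v y\<close>
  with weights \<open>h $ k\<close>. The triangle inequality leaves the l1 norm of \<open>h\<close>,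
  which costs sqrt m.\<close>

lemma norm_state_jacobian_le:
  fixes P :: "'m::finite \<Rightarrow> real^'n^'k"
  assumes "\<And>k. spectral_norm (P k) \<le> C"
  shows "norm ((\<chi> i k. (P k *v y) $ i) *v h) \<le> sqrt (real CARD('m)) * C * norm y * norm h"
proof -
  have C: "0 \<le> C" using assms spectral_norm_nonneg order_trans by blast
  have "(\<chi> i k. (P k *v y) $ i) *v h = (\<Sum>k\<in>UNIV. (h $ k) *\<^sub>R (P k *v y))"
    by (simp add: vec_eq_iff matrix_vector_mult_def[of _ h] mult.commute)
  also have "norm \<dots> \<le> (\<Sum>k\<in>UNIV. \<bar>h $ k\<bar> * (C * norm y))"
  proof (rule sum_norm_le)
    fix k
    have "norm (P k *v y) \<le> C * norm y"
      using spectral_norm_bound[of "P k" y] mult_right_mono[OF assms norm_ge_zero] order_trans by blast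
    then show "norm ((h $ k) *\<^sub>R (P k *v y)) \<le> \<bar>h $ k\<bar> * (C * norm y)"
      by (simp add: mult_left_mono)
  qed
  also have "\<dots> = (\<Sum>k\<in>UNIV. \<bar>h $ k\<bar>) * (C * norm y)" by (simp add: sum_distrib_right)
  also have "\<dots> \<le> sqrt (real CARD('m)) * norm h * (C * norm y)"
    by (intro mult_right_mono sum_abs_le_sqrt_card_norm) (simp add: C)
  finally show ?thesis by (simp add: ac_simps)
qed

lemma norm_residual_jacobian_le:
  fixes A :: "real^'m \<Rightarrow> real^'n^'n" and b :: "real^'m \<Rightarrow> real^'n"
  assumes "C1 A" "C1 b"
    and A: "\<And>k. spectral_norm (partial_deriv k A z) \<le> C_A"
    and b: "spectral_norm (jacobian b (at z)) \<le> C_b"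
  shows "norm (residual_jacobian A b z y *v h)
    \<le> (sqrt (real CARD('m)) * C_A * norm y + C_b) * norm h"
proof -
  have "norm (residual_jacobian A b z y *v h)
      \<le> norm ((\<chi> i k. (partial_deriv k A z *v y) $ i) *v h) + norm (jacobian b (at z) *v h)"
    unfolding residual_jacobian_eq[OF assms(1,2)] matrix_vector_mult_diff_rdistrib
    by (rule norm_triangle_ineq4)
  moreover have "norm (jacobian b (at z) *v h) \<le> C_b * norm h"
    using spectral_norm_bound mult_right_mono[OF b norm_ge_zero] order_trans by blast
  moreover note norm_state_jacobian_le[of "\<lambda>k. partial_deriv k A z", OF A]
  ultimately show ?thesis unfolding distrib_right by (meson add_mono order_trans)
qed

text \<open>The Jacobian of \<open>b\<close> cancels and the rest is linear in the state, so only
  \<open>C_A\<close> enters.\<close>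

lemma norm_residual_jacobian_diff_le:
  fixes A :: "real^'m \<Rightarrow> real^'n^'n" and b :: "real^'m \<Rightarrow> real^'n"
  assumes "C1 A" "C1 b"
    and A: "\<And>k. spectral_norm (partial_deriv k A z) \<le> C_A"
  shows "norm ((residual_jacobian A b z y - residual_jacobian A b z y') *v h)
    \<le> sqrt (real CARD('m)) * C_A * norm (y - y') * norm h"
proof -
  have "residual_jacobian A b z y - residual_jacobian A b z y'
      = (\<chi> i k. (partial_deriv k A z *v (y - y')) $ i)"
    unfolding residual_jacobian_eq[OF assms(1,2)]
    by (simp add: vec_eq_iff matrix_vector_mult_diff_distrib)
  then show ?thesis using norm_state_jacobian_le[of "\<lambda>k. partial_deriv k A z", OF A] by simp
qed

section \<open>Partial gradients of the objective\<close>

text \<open>Restricting the joint derivative to directions \<open>(h, 0)\<close> and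
  \<open>(0, h)\<close> picks out the two components. This turns the smoothness of \<open>F\<close>
  into bounds on its partial gradients.\<close>

lemma grad_pair:
  fixes F :: "(real^'m) \<times> (real^'n) \<Rightarrow> real"
  assumes "F differentiable (at (z, y))"
  shows "grad F (z, y) = (grad_z F z y, grad_y F z y)"
proof -
  obtain F' where "(F has_derivative F') (at (z, y))"
    using assms unfolding differentiable_def by blast
  then have G: "(F has_derivative (\<lambda>h. inner h (grad F (z, y)))) (at (z, y))"
    using has_derivative_imp_GDERIV unfolding gderiv_def by blast
  have "((\<lambda>z'. F (z', y)) has_derivative (\<lambda>h. inner (h, 0) (grad F (z, y)))) (at z)"
    by (rule has_derivative_compose[of "\<lambda>z'. (z', y)" "\<lambda>h. (h, 0)", OF _ G, simplified])
      (auto intro!: derivative_eq_intros)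
  then have "grad_z F z y = fst (grad F (z, y))"
    unfolding grad_z_def by (intro grad_unique) (simp add: gderiv_def inner_prod_def)
  moreover have "((\<lambda>y'. F (z, y')) has_derivative (\<lambda>h. inner (0, h) (grad F (z, y)))) (at y)"
    by (rule has_derivative_compose[of "\<lambda>y'. (z, y')" "\<lambda>h. (0, h)", OF _ G, simplified])
      (auto intro!: derivative_eq_intros)
  then have "grad_y F z y = snd (grad F (z, y))"
    unfolding grad_y_def by (intro grad_unique) (simp add: gderiv_def inner_prod_def)
  ultimately show ?thesis by simp
qed

lemma partial_grads_Lipschitz:
  fixes F :: "(real^'m) \<times> (real^'n) \<Rightarrow> real"
  assumes "C1 F" and L: "\<And>w\<^sub>1 w\<^sub>2. norm (grad F w\<^sub>1 - grad F w\<^sub>2) \<le> L * norm (w\<^sub>1 - w\<^sub>2)"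
  shows "norm (grad_z F z y - grad_z F z y') \<le> L * norm (y - y')"
    and "norm (grad_y F z y - grad_y F z y') \<le> L * norm (y - y')"
proof -
  have g: "grad F (z, y) = (grad_z F z y, grad_y F z y)" for y
    using assms(1) by (intro grad_pair C1_imp_differentiable)
  have "norm (grad_z F z y - grad_z F z y', grad_y F z y - grad_y F z y') \<le> L * norm (y - y')"
    using L[of "(z, y)" "(z, y')"] by (simp add: g norm_Pair)
  then show "norm (grad_z F z y - grad_z F z y') \<le> L * norm (y - y')"
    and "norm (grad_y F z y - grad_y F z y') \<le> L * norm (y - y')"
    using norm_fst_le norm_snd_le order_trans by blast+
qed

section \<open>Errors controlled by residuals, and finiteness of the suprema\<close>

lemma norm_le_C_R:
  fixes A :: "real^'m \<Rightarrow> real^'n^'n"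
  assumes "invertible (A z)"
  shows "norm x \<le> C_R A z * norm (A z *v x)"
proof -
  have "x = matrix_inv (A z) *v (A z *v x)"
    using assms by (simp add: matrix_vector_mul_assoc matrix_inv_left)
  then show ?thesis using spectral_norm_bound[of "matrix_inv (A z)" "A z *v x"]
    unfolding C_R_def by simp
qed

text \<open>The transposed inverse inverts the transpose and inherits the bound of the inverse, so
  state and adjoint errors share the constant \<open>C_R\<close>.\<close>

lemma norm_le_C_R_transpose:
  fixes A :: "real^'m \<Rightarrow> real^'n^'n"
  assumes "invertible (A z)"
  shows "norm \<psi> \<le> C_R A z * norm (transpose (A z) *v \<psi>)"
proof -
  have "transpose (matrix_inv (A z)) ** transpose (A z) = mat 1"
    using assms by (simp add: matrix_inv_right flip: matrix_transpose_mul)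
  then have "transpose (matrix_inv (A z)) *v (transpose (A z) *v \<psi>) = \<psi>"
    by (simp add: matrix_vector_mul_assoc del: transpose_matrix_vector)
  then show ?thesis
    using norm_transpose_mult_le[of "matrix_inv (A z)" _ "transpose (A z) *v \<psi>", OF spectral_norm_bound]
    unfolding C_R_def by metis
qed

lemma norm_diff_exact_state_le:
  fixes A :: "real^'m \<Rightarrow> real^'n^'n"
  assumes "invertible (A z)" "y \<in> inexact_states A b \<tau> z"
  shows "norm (y - exact_state A b z) \<le> C_R A z * \<tau>"
proof -
  have "A z *v (y - exact_state A b z) = residual A b z y"
    using exact_state_solves[where A=A and z=z and b=b] assms(1)
    by (simp add: matrix_vector_mult_diff_distrib residual_def)
  then have "norm (y - exact_state A b z) \<le> C_R A z * norm (residual A b z y)"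
    using norm_le_C_R[where A=A and z=z and x="y - exact_state A b z"] assms(1) by simp
  also have "\<dots> \<le> C_R A z * \<tau>"
    using assms(2) by (intro mult_left_mono) (simp_all add: inexact_states_def C_R_def spectral_norm_nonneg)
  finally show ?thesis .
qed

text \<open>A real supremum bounds its members only over a set bounded above; here the inexact
  states lie in a ball around the exact state.\<close>

lemma norm_le_C_Y:
  fixes A :: "real^'m \<Rightarrow> real^'n^'n"
  assumes "invertible (A z)" "y \<in> inexact_states A b \<tau> z"
  shows "norm y \<le> C_Y A b \<tau> z"
proof -
  have "norm y \<le> norm (exact_state A b z) + C_R A z * \<tau>" if "y \<in> inexact_states A b \<tau> z" for y
    using norm_diff_exact_state_le[where A=A and z=z, OF assms(1) that]
      norm_triangle_sub[of y "exact_state A b z"] by linarith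
  then have "bdd_above (norm ` inexact_states A b \<tau> z)" by (intro bdd_aboveI2)
  then show ?thesis unfolding C_Y_def using assms(2) by (intro cSUP_upper)
qed

text \<open>Boundedness again has to be shown first: a Lipschitz map has bounded image on the
  bounded set of inexact states.\<close>

lemma norm_grad_y_le_M_F:
  fixes A :: "real^'m \<Rightarrow> real^'n^'n"
  assumes "invertible (A z)" "y \<in> inexact_states A b \<tau> z" "0 \<le> L"
    and L: "\<And>y y'. norm (grad_y F z y - grad_y F z y') \<le> L * norm (y - y')"
  shows "norm (grad_y F z y) \<le> M_F A b F \<tau> z"
proof -
  have "norm (grad_y F z y) \<le> norm (grad_y F z (exact_state A b z)) + L * (C_R A z * \<tau>)"
    if "y \<in> inexact_states A b \<tau> z" for y
  proof -
    have "norm (grad_y F z y - grad_y F z (exact_state A b z)) \<le> L * (C_R A z * \<tau>)"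
      using L[of y "exact_state A b z"] \<open>0 \<le> L\<close>
        mult_left_mono[OF norm_diff_exact_state_le[where A=A and z=z, OF assms(1) that]] order_trans by blast
    then show ?thesis using norm_triangle_sub[of "grad_y F z y" "grad_y F z (exact_state A b z)"]
      by linarith
  qed
  then have "bdd_above ((\<lambda>y. norm (grad_y F z y)) ` inexact_states A b \<tau> z)" by (intro bdd_aboveI2)
  then show ?thesis unfolding M_F_def using assms(2) by (intro cSUP_upper)
qed

theorem theorem3p10:
  fixes A :: "real^'m \<Rightarrow> real^'n^'n"
    and b :: "real^'m \<Rightarrow> real^'n"
    and F :: "(real^'m) \<times> (real^'n) \<Rightarrow> real"
    and z\<^sub>0 :: "real^'m"
    and \<tau>\<^sub>R \<tau>\<^sub>\<psi> C_A L_b C_b L_F :: real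
    and L_A :: "'m \<Rightarrow> real"
  assumes "C1 A" and "C1 b" and "\<And>z. invertible (A z)"
    and "\<tau>\<^sub>R > 0" and "\<tau>\<^sub>\<psi> > 0"
    and "\<And>k. L_A k > 0"
    and "\<And>k z z'. spectral_norm (partial_deriv k A z - partial_deriv k A z') \<le> L_A k * norm (z - z')"
    and "C_A > 0"
    and "\<And>k z. spectral_norm (partial_deriv k A z) \<le> C_A"
    and "L_b > 0"
    and "\<And>z z'. spectral_norm (jacobian b (at z) - jacobian b (at z')) \<le> L_b * norm (z - z')"
    and "C_b > 0"
    and "\<And>z. spectral_norm (jacobian b (at z)) \<le> C_b"
    and "C1 F"
    and "\<And>w\<^sub>1 w\<^sub>2. norm (grad F w\<^sub>1 - grad F w\<^sub>2) \<le> L_F * norm (w\<^sub>1 - w\<^sub>2)"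
  defines "D_R \<equiv> L_F * C_R A z\<^sub>0
      + L_F * (sqrt (real CARD('m)) * C_A * C_Y A b \<tau>\<^sub>R z\<^sub>0 + C_b) * (C_R A z\<^sub>0)\<^sup>2
      + sqrt (real CARD('m)) * C_A * M_F A b F \<tau>\<^sub>R z\<^sub>0 * (C_R A z\<^sub>0)\<^sup>2"
    and "D_\<psi> \<equiv> (sqrt (real CARD('m)) * C_A * C_Y A b \<tau>\<^sub>R z\<^sub>0 + C_b) * C_R A z\<^sub>0"
  shows "\<forall>y \<in> inexact_states A b \<tau>\<^sub>R z\<^sub>0. \<forall>\<psi> \<in> inexact_adjoints A F \<tau>\<^sub>\<psi> z\<^sub>0 y.
    norm (adjoint_gradient A b F z\<^sub>0 y \<psi> - reduced_gradient A b F z\<^sub>0)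
      \<le> D_R * \<tau>\<^sub>R + D_\<psi> * \<tau>\<^sub>\<psi>"
proof (intro ballI)
  fix y \<psi>
  assume y: "y \<in> inexact_states A b \<tau>\<^sub>R z\<^sub>0" and \<psi>: "\<psi> \<in> inexact_adjoints A F \<tau>\<^sub>\<psi> z\<^sub>0 y"
  define y\<^sub>e where "y\<^sub>e = exact_state A b z\<^sub>0"
  define \<psi>\<^sub>y where "\<psi>\<^sub>y = exact_adjoint A F z\<^sub>0 y"
  define \<psi>\<^sub>e where "\<psi>\<^sub>e = exact_adjoint A F z\<^sub>0 y\<^sub>e"
  define J where "J = residual_jacobian A b z\<^sub>0"
  define s where "s = sqrt (real CARD('m))"
  define c where "c = C_R A z\<^sub>0"
  define K where "K = s * C_A * C_Y A b \<tau>\<^sub>R z\<^sub>0 + C_b"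
  note inv = assms(3)[of z\<^sub>0]
  note L = partial_grads_Lipschitz[OF assms(14,15)]

  have s: "0 \<le> s" and c: "0 \<le> c" by (simp_all add: s_def c_def C_R_def spectral_norm_nonneg)
  \<comment> \<open>The sign follows from the Lipschitz inequality at two points at distance
    1.\<close>
  have LF: "0 \<le> L_F"
  proof -
    have "0 \<le> L_F * norm (0 - (0, axis undefined 1) :: (real^'m) \<times> (real^'n))"
      using assms(15) norm_ge_zero order_trans by blast
    then show ?thesis by (simp add: norm_Pair)
  qed
  have e: "norm (y - y\<^sub>e) \<le> c * \<tau>\<^sub>R"
    unfolding y\<^sub>e_def c_def by (rule norm_diff_exact_state_le[where A=A and z=z\<^sub>0, OF inv y])
  have Le: "L_F * norm (y - y\<^sub>e) \<le> L_F * (c * \<tau>\<^sub>R)" by (intro mult_left_mono e LF)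
  \<comment> \<open>Its residual is zero, so \<open>M_F\<close> also bounds the gradient at the
    exact state, and with it the exact adjoint there.\<close>
  have y\<^sub>e: "y\<^sub>e \<in> inexact_states A b \<tau>\<^sub>R z\<^sub>0"
    using exact_state_solves[of A z\<^sub>0 b, OF inv] assms(4)
    by (simp add: inexact_states_def residual_def y\<^sub>e_def)
  have adj: "transpose (A z\<^sub>0) *v \<psi>\<^sub>y = grad_y F z\<^sub>0 y" "transpose (A z\<^sub>0) *v \<psi>\<^sub>e = grad_y F z\<^sub>0 y\<^sub>e"
    unfolding \<psi>\<^sub>y_def \<psi>\<^sub>e_def by (rule exact_adjoint_solves[where A=A and z=z\<^sub>0, OF inv])+

  have K: "s * C_A * norm y + C_b \<le> K"
    unfolding K_def using s assms(8) norm_le_C_Y[where A=A and z=z\<^sub>0, OF inv y] by (intro add_right_mono mult_left_mono) auto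
  have K0: "0 \<le> K"
    using K s assms(8,12) by (meson add_nonneg_nonneg less_imp_le mult_nonneg_nonneg norm_ge_zero order_trans)
  have "norm (J y *v h) \<le> K * norm h" for h
    using norm_residual_jacobian_le[OF assms(1,2), of z\<^sub>0 C_A C_b y h, OF assms(9) assms(13)]
      mult_right_mono[OF K norm_ge_zero[of h]]
    unfolding J_def s_def by linarith
  note JT = norm_transpose_mult_le[of "J y", OF this]

  have "norm (\<psi> - \<psi>\<^sub>y) \<le> c * norm (transpose (A z\<^sub>0) *v \<psi> - grad_y F z\<^sub>0 y)"
    using norm_le_C_R_transpose[of A z\<^sub>0 "\<psi> - \<psi>\<^sub>y", OF inv]
    by (simp only: matrix_vector_mult_diff_distrib adj c_def)
  also have "\<dots> \<le> c * \<tau>\<^sub>\<psi>"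
    using \<psi> c by (intro mult_left_mono) (simp_all add: inexact_adjoints_def)
  finally have "K * norm (\<psi> - \<psi>\<^sub>y) \<le> K * (c * \<tau>\<^sub>\<psi>)" using K0 by (intro mult_left_mono)
  with JT have 1: "norm (transpose (J y) *v (\<psi> - \<psi>\<^sub>y)) \<le> K * (c * \<tau>\<^sub>\<psi>)" by (rule order_trans)

  \<comment> \<open>Both adjoints solve systems with the same matrix, so only the right-hand sides
    differ. One factor \<open>c\<close> comes from inverting the transpose, the other from the state
    error.\<close>
  have "norm (\<psi>\<^sub>y - \<psi>\<^sub>e) \<le> c * norm (grad_y F z\<^sub>0 y - grad_y F z\<^sub>0 y\<^sub>e)"
    using norm_le_C_R_transpose[of A z\<^sub>0 "\<psi>\<^sub>y - \<psi>\<^sub>e", OF inv]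
    by (simp only: matrix_vector_mult_diff_distrib adj c_def)
  also have "\<dots> \<le> c * (L_F * (c * \<tau>\<^sub>R))"
    using order_trans[OF L(2) Le] c by (intro mult_left_mono)
  finally have "K * norm (\<psi>\<^sub>y - \<psi>\<^sub>e) \<le> K * (c * (L_F * (c * \<tau>\<^sub>R)))" using K0 by (intro mult_left_mono)
  with JT have 2: "norm (transpose (J y) *v (\<psi>\<^sub>y - \<psi>\<^sub>e)) \<le> K * (c * (L_F * (c * \<tau>\<^sub>R)))"
    by (rule order_trans)

  have "norm \<psi>\<^sub>e \<le> c * norm (grad_y F z\<^sub>0 y\<^sub>e)"
    using norm_le_C_R_transpose[of A z\<^sub>0 "\<psi>\<^sub>e", OF inv] by (simp only: adj c_def)
  also have "\<dots> \<le> c * M_F A b F \<tau>\<^sub>R z\<^sub>0"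
    using norm_grad_y_le_M_F[where A=A and z=z\<^sub>0, OF inv y\<^sub>e LF L(2)] c by (intro mult_left_mono)
  finally have \<psi>\<^sub>e: "norm \<psi>\<^sub>e \<le> c * M_F A b F \<tau>\<^sub>R z\<^sub>0" .
  \<comment> \<open>Pairing the Jacobian difference with the adjoint at the exact state keeps this
    term linear in the tolerances.\<close>
  have "norm (transpose (J y - J y\<^sub>e) *v \<psi>\<^sub>e) \<le> s * C_A * norm (y - y\<^sub>e) * norm \<psi>\<^sub>e"
    unfolding J_def s_def
    by (intro norm_transpose_mult_le norm_residual_jacobian_diff_le assms(1,2,9))
  also have "\<dots> \<le> s * C_A * (c * \<tau>\<^sub>R) * (c * M_F A b F \<tau>\<^sub>R z\<^sub>0)"
    using s c assms(4,8) e \<psi>\<^sub>e by (intro mult_mono mult_left_mono) auto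
  finally have 3: "norm (transpose (J y - J y\<^sub>e) *v \<psi>\<^sub>e)
      \<le> s * C_A * (c * \<tau>\<^sub>R) * (c * M_F A b F \<tau>\<^sub>R z\<^sub>0)" .

  have "transpose (J y - J y\<^sub>e) = transpose (J y) - transpose (J y\<^sub>e)"
    by (simp add: transpose_def vec_eq_iff)
  then have "adjoint_gradient A b F z\<^sub>0 y \<psi> - reduced_gradient A b F z\<^sub>0
      = (grad_z F z\<^sub>0 y - grad_z F z\<^sub>0 y\<^sub>e) - transpose (J y) *v (\<psi> - \<psi>\<^sub>y)
        - transpose (J y) *v (\<psi>\<^sub>y - \<psi>\<^sub>e) - transpose (J y - J y\<^sub>e) *v \<psi>\<^sub>e"
    unfolding reduced_gradient_eq(2)[OF assms(1,2,14,3)] adjoint_gradient_def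
      J_def[symmetric] y\<^sub>e_def[symmetric] \<psi>\<^sub>e_def[symmetric]
    by (simp add: matrix_vector_mult_diff_distrib matrix_vector_mult_diff_rdistrib
        del: transpose_matrix_vector)
  also have "norm \<dots> \<le> L_F * (c * \<tau>\<^sub>R) + K * (c * \<tau>\<^sub>\<psi>) + K * (c * (L_F * (c * \<tau>\<^sub>R)))
      + s * C_A * (c * \<tau>\<^sub>R) * (c * M_F A b F \<tau>\<^sub>R z\<^sub>0)"
    by (intro norm_triangle_le_diff add_mono 1 2 3 order_trans[OF L(1) Le])
  \<comment> \<open>The first, third and fourth summands are the three terms of \<open>D_R\<close>
    times \<open>\<tau>\<^sub>R\<close>, in that order; the second is the adjoint tolerance
    term.\<close>
  also have "\<dots> = D_R * \<tau>\<^sub>R + D_\<psi> * \<tau>\<^sub>\<psi>"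
    unfolding D_R_def D_\<psi>_def K_def s_def c_def by (simp add: algebra_simps power2_eq_square)
  finally show "norm (adjoint_gradient A b F z\<^sub>0 y \<psi> - reduced_gradient A b F z\<^sub>0)
      \<le> D_R * \<tau>\<^sub>R + D_\<psi> * \<tau>\<^sub>\<psi>" .
qed

end
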